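(* Let $\boldsymbol Z\in\mathbb{R}^{d_Z}$ be a random vector and consider $Y=\eta h(\boldsymbol Z)+\varepsilon$, where $\varepsilon\in\mathbb{R}$ and $h(\boldsymbol Z)\in\mathbb{R}$ are independent, continuous random variables, and $\eta\ge 0$. Then $T^{\mathrm{AC}}(Y,\boldsymbol Z)$ is monotonically increasing with $\eta$, i.e., writing $Y_\eta=\eta h(\boldsymbol Z)+\varepsilon$, one has $T^{\mathrm{AC}}(Y_{\eta_1},\boldsymbol Z)\le T^{\mathrm{AC}}(Y_{\eta_2},\boldsymbol Z)$ for all $0\le\eta_1<\eta_2$.
   Context: Here $h$ is a real-valued function on $\mathbb{R}^{d_Z}$ such that $h(\boldsymbol Z)$ is a random variable, and $\varepsilon$ is defined on the same probability space as $\boldsymbol Z$. A real random variable is continuous if its distribution function is continuous (no atoms). For a real random variable $Y$ with law $\mu_Y$ that is not almost surely constant and a random vector $\boldsymbol Z$ on the same probability space, $$T^{\mathrm{AC}}(Y,\boldsymbol Z):=\frac{\int\mathrm{var}(\mathbb{P}(Y\ge y\mid\boldsymbol Z))\,d\mu_Y(y)}{\int\mathrm{var}(\mathbb{1}\{Y\ge y\})\,d\mu_Y(y)}.$$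
   Formalization: The noise ε is assumed independent of the whole vector Z, not only of h(Z) (with independence of h(Z) alone the claim can fail when other components of Z inform on ε), and h(Z) is taken to be measurable with respect to the sigma-algebra generated by Z. *)

theory Defs
  imports "HOL-Probability.Probability"
begin

definition continuous_rv :: "'a measure \<Rightarrow> ('a \<Rightarrow> real) \<Rightarrow> bool" where
  "continuous_rv M X \<longleftrightarrow>
     X \<in> borel_measurable M \<and> continuous_on UNIV (cdf (distr M borel X))"

definition sigma_of :: "'a measure \<Rightarrow> ('a \<Rightarrow> 'z::topological_space) \<Rightarrow> 'a measure" where
  "sigma_of M Z = vimage_algebra (space M) Z borel"

definition cond_survival ::
    "'a measure \<Rightarrow> ('a \<Rightarrow> real) \<Rightarrow> ('a \<Rightarrow> 'z::topological_space) \<Rightarrow> real \<Rightarrow> 'a \<Rightarrow> real" where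
  "cond_survival M Y Z y = real_cond_exp M (sigma_of M Z) (indicator {\<omega>. Y \<omega> \<ge> y})"

text \<open>
  The denominator is positive exactly when \<open>Y\<close> is not almost surely constant; only then is
  the quotient meaningful. Both integrands are bounded measurable functions of \<open>y\<close>
  (differences of monotone functions), so neither integral takes the default value \<open>0\<close>
  of a non-integrable function.
\<close>

definition T_AC :: "'a measure \<Rightarrow> ('a \<Rightarrow> real) \<Rightarrow> ('a \<Rightarrow> 'z::topological_space) \<Rightarrow> real" where
  "T_AC M Y Z =
     (\<integral>y. prob_space.variance M (cond_survival M Y Z y) \<partial>distr M borel Y) /
     (\<integral>y. prob_space.variance M (indicator {\<omega>. Y \<omega> \<ge> y}) \<partial>distr M borel Y)"

end

theory Submission
  imports Defs
begin

text \<open>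
  Write \<open>X = h(Z)\<close>, let \<open>S(u) = P(\<epsilon> \<ge> u)\<close> be the survival function of the noise and \<open>\<mu>\<close> the law of
  \<open>Y = \<eta> X + \<epsilon>\<close>. Since the noise has no atoms and is independent of \<open>Z\<close>, neither has \<open>Y\<close>. For
  an atomless law, \<open>P(Y \<ge> y)\<close> and \<open>P(Y \<ge> y)\<^sup>2\<close> integrate to \<open>1/2\<close> and \<open>1/3\<close> over \<open>\<mu>\<close>, so the
  denominator of the coefficient is \<open>1/6\<close> whatever \<open>\<eta>\<close> is, and everything depends on the numerator.

  Conditionally on \<open>Z\<close> the signal is a constant, so \<open>P(Y \<ge> y | Z) = S(y - \<eta> X)\<close>. Integrating its
  variance over \<open>\<mu>\<close>, with an independent copy \<open>X'\<close> of the signal, gives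
  \<open>E[\<Phi>(\<eta> (X - X'))] - 1/3\<close>, where \<open>\<Phi>(t)\<close> is the integral of \<open>S(e + t)\<^sup>2\<close> over the noise law
  (lemma \<open>integral_variance_cond_prob\<close>).

  The function \<open>\<Phi>\<close> itself is decreasing. However, \<open>X - X'\<close> is symmetric, so only
  \<open>\<Phi>(t) + \<Phi>(-t)\<close> matters, and this sum increases with \<open>\<bar>t\<bar>\<close>. The reason is the identity
  \<open>S(u)\<^sup>2 = 2 E[S(\<epsilon>); \<epsilon> \<ge> u]\<close>: two independent noises both exceed \<open>u\<close> exactly when the smaller one
  does, and each is equally likely to be the smaller one (lemma
  \<open>square_measure_upward_closed\<close>). With it, \<open>\<Phi>(t) + \<Phi>(-t)\<close> becomes twice the mean, over independent
  noises \<open>e\<close> and \<open>s\<close>, of the expression that is \<open>S(s)\<close> if \<open>s - e > t\<close> and \<open>S(e)\<close> otherwise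
  (lemma \<open>shift_moment_symmetrized\<close>). For \<open>t \<ge> 0\<close> this expression increases with \<open>t\<close> pointwise, because
  a pair can only switch from \<open>S(s)\<close> to \<open>S(e)\<close>, and does so with \<open>e < s\<close>.
\<close>

section \<open>Fubini for bounded functions\<close>

lemma (in prob_space) integrable_bounded:
  fixes f :: "'a \<Rightarrow> real"
  assumes "f \<in> borel_measurable M" and "\<And>x. \<bar>f x\<bar> \<le> B"
  shows "integrable M f"
  using assms by (intro integrable_const_bound[of _ B]) auto

lemma Fubini_bounded:
  fixes f :: "'a \<Rightarrow> 'b \<Rightarrow> real"
  assumes "prob_space P" and "prob_space Q"
    and "case_prod f \<in> borel_measurable (P \<Otimes>\<^sub>M Q)" and "\<And>x y. \<bar>f x y\<bar> \<le> B"
  shows "(\<integral>y. (\<integral>x. f x y \<partial>P) \<partial>Q) = (\<integral>x. (\<integral>y. f x y \<partial>Q) \<partial>P)"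
proof -
  interpret P: prob_space P by fact
  interpret Q: prob_space Q by fact
  interpret PQ: pair_prob_space P Q ..
  show ?thesis
    using assms(3,4) by (intro PQ.Fubini_integral PQ.integrable_bounded[of _ B]) auto
qed

lemma integral_pair_bounded:
  fixes f :: "'a \<times> 'b \<Rightarrow> real"
  assumes "prob_space P" and "prob_space Q"
    and "f \<in> borel_measurable (P \<Otimes>\<^sub>M Q)" and "\<And>z. \<bar>f z\<bar> \<le> B"
  shows "(\<integral>z. f z \<partial>(P \<Otimes>\<^sub>M Q)) = (\<integral>y. (\<integral>x. f (x, y) \<partial>P) \<partial>Q)"
proof -
  interpret P: prob_space P by fact
  interpret Q: prob_space Q by fact
  interpret PQ: pair_prob_space P Q ..
  show ?thesis
    using PQ.integral_snd[of "\<lambda>x y. f (x, y)"] PQ.integrable_bounded[of f B] assms(3,4) by simp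
qed

lemma (in prob_space) abs_integral_le:
  fixes f :: "'a \<Rightarrow> real"
  assumes "f \<in> borel_measurable M" and "\<And>x. \<bar>f x\<bar> \<le> B"
  shows "\<bar>\<integral>x. f x \<partial>M\<bar> \<le> B"
proof -
  have "0 \<le> B"
    using assms(2)[of undefined] by linarith
  have "\<bar>\<integral>x. f x \<partial>M\<bar> \<le> (\<integral>x. \<bar>f x\<bar> \<partial>M)"
    by (rule integral_abs_bound)
  also have "\<dots> \<le> (\<integral>x. B \<partial>M)"
    using assms integrable_bounded[of "\<lambda>x. \<bar>f x\<bar>" B] by (intro integral_mono) auto
  finally show ?thesis
    by (simp add: prob_space)
qed

section \<open>Survival functions of atomless laws\<close>

definition survival :: "real measure \<Rightarrow> real \<Rightarrow> real" where
  "survival \<mu> u = measure \<mu> {u..}"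

locale atomless_distribution = real_distribution \<mu> for \<mu> :: "real measure" +
  assumes atomless: "measure \<mu> {x} = 0"
begin

lemma survival_bounds: "0 \<le> survival \<mu> u" "survival \<mu> u \<le> 1"
  by (simp_all add: survival_def)

lemma abs_survival_le: "\<bar>survival \<mu> u\<bar> \<le> 1"
  using survival_bounds[of u] by simp

lemma abs_survival_square_le: "\<bar>(survival \<mu> u)\<^sup>2\<bar> \<le> 1"
  using survival_bounds[of u] by (simp add: power_le_one)

lemma survival_antimono: "u \<le> v \<Longrightarrow> survival \<mu> v \<le> survival \<mu> u"
  by (auto simp: survival_def intro!: finite_measure_mono)

lemma borel_measurable_survival [measurable]: "survival \<mu> \<in> borel_measurable borel"
proof -
  have "mono (\<lambda>u. - survival \<mu> u)"
    by (intro monoI) (simp add: survival_antimono)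
  from borel_measurable_mono[OF this] have "(\<lambda>u. - (- survival \<mu> u)) \<in> borel_measurable borel"
    by (rule borel_measurable_uminus)
  then show ?thesis
    by simp
qed

lemma survival_eq_greaterThan: "survival \<mu> u = measure \<mu> {u<..}"
proof -
  have "measure \<mu> ({u} \<union> {u<..}) = measure \<mu> {u} + measure \<mu> {u<..}"
    by (intro finite_measure_Union) auto
  moreover have "{u} \<union> {u<..} = {u..}"
    by auto
  ultimately show ?thesis
    by (simp add: survival_def atomless)
qed

lemma measure_atMost: "measure \<mu> {..u} = 1 - survival \<mu> u"
proof -
  have "UNIV - {u<..} = {..u}"
    by auto
  then show ?thesis
    using prob_compl[of "{u<..}"] by (simp add: survival_eq_greaterThan)
qed

lemma AE_neq: "AE t in \<mu>. t \<noteq> s"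
proof (rule AE_I')
  show "{s} \<in> null_sets \<mu>"
    using atomless[of s] by (auto simp: null_sets_def emeasure_eq_measure)
qed auto

text \<open>
  The square on the left is the probability that two independent draws from the law both lie in
  \<open>A\<close>. Almost surely the draws differ, and by symmetry this probability is twice that of the
  smaller draw being the first one, in which case upward closure puts the second draw
  into \<open>A\<close> for free.
\<close>

lemma square_measure_upward_closed:
  assumes A [measurable]: "A \<in> sets borel"
    and up: "\<And>s t. s \<in> A \<Longrightarrow> s \<le> t \<Longrightarrow> t \<in> A"
  shows "(measure \<mu> A)\<^sup>2 = 2 * (\<integral>s. indicator A s * survival \<mu> s \<partial>\<mu>)"
proof -
  define k :: "real \<Rightarrow> real \<Rightarrow> real" where "k s t = indicator A s * (if s \<le> t then 1 else 0)" for s t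
  have k_bound: "\<bar>k s t\<bar> \<le> 1" for s t
    by (auto simp: k_def indicator_def)
  have k_meas [measurable]: "(\<lambda>(s, t). k s t) \<in> borel_measurable (borel \<Otimes>\<^sub>M borel)"
    unfolding k_def by measurable
  have k_meas1 [measurable]: "(\<lambda>t. k s t) \<in> borel_measurable borel"
    "(\<lambda>t. k t s) \<in> borel_measurable borel" for s
    unfolding k_def by measurable
  have k_int: "(\<integral>t. k s t \<partial>\<mu>) = indicator A s * survival \<mu> s" for s
  proof -
    have "(\<integral>t. k s t \<partial>\<mu>) = (\<integral>t. indicator A s * indicator {s..} t \<partial>\<mu>)"
      by (intro Bochner_Integration.integral_cong) (auto simp: k_def indicator_def)
    then show ?thesis
      by (simp add: survival_def)
  qed
  have inner: "indicator A s * measure \<mu> A = (\<integral>t. k s t \<partial>\<mu>) + (\<integral>t. k t s \<partial>\<mu>)" for s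
  proof -
    have "indicator A s * measure \<mu> A = (\<integral>t. indicator A s * indicator A t \<partial>\<mu>)"
      by simp
    also have "\<dots> = (\<integral>t. k s t + k t s \<partial>\<mu>)"
    proof (rule integral_cong_AE)
      show "AE t in \<mu>. indicator A s * indicator A t = k s t + k t s"
        using AE_neq[of s]
      proof eventually_elim
        case (elim t)
        then show ?case
          using up[of s t] up[of t s] by (auto simp: k_def indicator_def)
      qed
    qed measurable
    also have "\<dots> = (\<integral>t. k s t \<partial>\<mu>) + (\<integral>t. k t s \<partial>\<mu>)"
      using k_bound by (intro Bochner_Integration.integral_add integrable_bounded[of _ 1]) auto
    finally show ?thesis .
  qed
  have k_bound_int: "\<bar>\<integral>t. k s t \<partial>\<mu>\<bar> \<le> 1" "\<bar>\<integral>t. k t s \<partial>\<mu>\<bar> \<le> 1" for s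
    using k_bound by (auto intro!: abs_integral_le)
  have "(measure \<mu> A)\<^sup>2 = (\<integral>s. indicator A s * measure \<mu> A \<partial>\<mu>)"
    by (simp add: power2_eq_square)
  also have "\<dots> = (\<integral>s. (\<integral>t. k s t \<partial>\<mu>) + (\<integral>t. k t s \<partial>\<mu>) \<partial>\<mu>)"
    by (simp add: inner)
  also have "\<dots> = (\<integral>s. (\<integral>t. k s t \<partial>\<mu>) \<partial>\<mu>) + (\<integral>s. (\<integral>t. k t s \<partial>\<mu>) \<partial>\<mu>)"
    using k_bound_int by (intro Bochner_Integration.integral_add integrable_bounded[of _ 1]) measurable
  also have "(\<integral>s. (\<integral>t. k t s \<partial>\<mu>) \<partial>\<mu>) = (\<integral>s. (\<integral>t. k s t \<partial>\<mu>) \<partial>\<mu>)"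
    using k_bound by (intro Fubini_bounded[of _ _ _ 1] prob_space_axioms) measurable
  finally show ?thesis
    by (simp add: k_int)
qed

lemma integral_survival: "(\<integral>s. survival \<mu> s \<partial>\<mu>) = 1/2"
  using square_measure_upward_closed[of UNIV] prob_space by simp

lemma survival_square:
  "(survival \<mu> u)\<^sup>2 = 2 * (\<integral>s. (if u \<le> s then survival \<mu> s else 0) \<partial>\<mu>)"
proof -
  have "(\<integral>s. indicator {u..} s * survival \<mu> s \<partial>\<mu>)
      = (\<integral>s. (if u \<le> s then survival \<mu> s else 0) \<partial>\<mu>)"
    by (intro Bochner_Integration.integral_cong) auto
  then show ?thesis
    using square_measure_upward_closed[of "{u..}"] by (simp add: survival_def)
qed

lemma survival_square_strict:
  "(survival \<mu> u)\<^sup>2 = 2 * (\<integral>s. (if u < s then survival \<mu> s else 0) \<partial>\<mu>)"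
proof -
  have "(\<integral>s. indicator {u<..} s * survival \<mu> s \<partial>\<mu>)
      = (\<integral>s. (if u < s then survival \<mu> s else 0) \<partial>\<mu>)"
    by (intro Bochner_Integration.integral_cong) auto
  then show ?thesis
    using square_measure_upward_closed[of "{u<..}"] by (simp add: survival_eq_greaterThan)
qed

text \<open>
  Expanding the square and integrating over \<open>u\<close> first weights \<open>S(s)\<close> by the mass \<open>1 - S(s)\<close> below \<open>s\<close>.
  The unknown integral thus reappears on the right, and the resulting linear equation has the
  solution \<open>1/3\<close>.
\<close>

lemma integral_survival_square: "(\<integral>u. (survival \<mu> u)\<^sup>2 \<partial>\<mu>) = 1/3"
proof -
  have "(\<integral>u. (survival \<mu> u)\<^sup>2 \<partial>\<mu>)
      = 2 * (\<integral>u. (\<integral>s. (if u \<le> s then survival \<mu> s else 0) \<partial>\<mu>) \<partial>\<mu>)"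
    by (simp add: survival_square)
  also have "(\<integral>u. (\<integral>s. (if u \<le> s then survival \<mu> s else 0) \<partial>\<mu>) \<partial>\<mu>)
      = (\<integral>s. (\<integral>u. (if u \<le> s then survival \<mu> s else 0) \<partial>\<mu>) \<partial>\<mu>)"
    by (intro Fubini_bounded[of _ _ _ 1] prob_space_axioms)
      (auto simp: survival_bounds split_beta')
  also have "\<dots> = (\<integral>s. survival \<mu> s - (survival \<mu> s)\<^sup>2 \<partial>\<mu>)"
  proof (intro Bochner_Integration.integral_cong refl)
    fix s
    have "(\<integral>u. (if u \<le> s then survival \<mu> s else 0) \<partial>\<mu>)
        = (\<integral>u. survival \<mu> s * indicator {..s} u \<partial>\<mu>)"
      by (intro Bochner_Integration.integral_cong) auto
    also have "\<dots> = survival \<mu> s * (1 - survival \<mu> s)"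
      by (simp add: measure_atMost)
    finally show "(\<integral>u. (if u \<le> s then survival \<mu> s else 0) \<partial>\<mu>)
        = survival \<mu> s - (survival \<mu> s)\<^sup>2"
      by (simp add: power2_eq_square algebra_simps)
  qed
  also have "\<dots> = (\<integral>s. survival \<mu> s \<partial>\<mu>) - (\<integral>s. (survival \<mu> s)\<^sup>2 \<partial>\<mu>)"
    using abs_survival_le abs_survival_square_le
    by (intro Bochner_Integration.integral_diff integrable_bounded[of _ 1]) auto
  finally show ?thesis
    by (simp add: integral_survival)
qed

section \<open>Shifted survival functions\<close>

text \<open>
  This is the probability that two independent draws both exceed a third one by at least \<open>t\<close>.
\<close>

definition shift_moment :: "real \<Rightarrow> real" where
  "shift_moment t = (\<integral>e. (survival \<mu> (e + t))\<^sup>2 \<partial>\<mu>)"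

lemma borel_measurable_shift_moment [measurable]: "shift_moment \<in> borel_measurable borel"
  unfolding shift_moment_def by measurable

lemma abs_shift_moment_le: "\<bar>shift_moment t\<bar> \<le> 1"
  unfolding shift_moment_def using abs_survival_square_le by (intro abs_integral_le) auto

lemma integral_survival_square_shift:
  fixes Y :: "'b \<Rightarrow> real"
  assumes R: "prob_space R" and Y [measurable]: "Y \<in> borel_measurable R"
  shows "(\<integral>e. (\<integral>x. (survival \<mu> (c + e - Y x))\<^sup>2 \<partial>R) \<partial>\<mu>)
    = (\<integral>x. shift_moment (c - Y x) \<partial>R)"
proof -
  have "(\<integral>e. (\<integral>x. (survival \<mu> (c + e - Y x))\<^sup>2 \<partial>R) \<partial>\<mu>)
      = (\<integral>x. (\<integral>e. (survival \<mu> (c + e - Y x))\<^sup>2 \<partial>\<mu>) \<partial>R)"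
    using abs_survival_square_le
    by (intro Fubini_bounded[of _ _ _ 1] prob_space_axioms R) measurable
  also have "\<dots> = (\<integral>x. shift_moment (c - Y x) \<partial>R)"
    by (simp add: shift_moment_def algebra_simps)
  finally show ?thesis .
qed

text \<open>
  Both squares are expanded as integrals of the survival function over an upper half-line. In the
  expansion for \<open>- t\<close> the two integration variables are exchanged; the half-planes
  \<open>s > e + t\<close> and \<open>e \<ge> s - t\<close> are then complementary and the two integrals merge into one. Opposite
  choices of strict and weak inequality make the half-planes complementary on the nose.
\<close>

lemma shift_moment_symmetrized:
  "shift_moment t + shift_moment (- t)
    = 2 * (\<integral>e. (\<integral>s. (if s - e > t then survival \<mu> s else survival \<mu> e) \<partial>\<mu>) \<partial>\<mu>)"
proof -
  define f where "f e s = (if e + t < s then survival \<mu> s else 0)" for e s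
  define g where "g e s = (if s - t \<le> e then survival \<mu> e else 0)" for e s
  have bound: "\<bar>f e s\<bar> \<le> 1" "\<bar>g e s\<bar> \<le> 1" for e s
    using abs_survival_le by (auto simp: f_def g_def)
  have meas [measurable]: "case_prod f \<in> borel_measurable (borel \<Otimes>\<^sub>M borel)"
      "case_prod g \<in> borel_measurable (borel \<Otimes>\<^sub>M borel)"
    unfolding f_def g_def by measurable
  have meas1 [measurable]: "f e \<in> borel_measurable borel" "g e \<in> borel_measurable borel"
      for e
    unfolding f_def g_def by measurable
  have bound_int: "\<bar>\<integral>s. f e s \<partial>\<mu>\<bar> \<le> 1" "\<bar>\<integral>s. g e s \<partial>\<mu>\<bar> \<le> 1" for e
    using bound by (auto intro!: abs_integral_le)
  have pos: "shift_moment t = 2 * (\<integral>e. (\<integral>s. f e s \<partial>\<mu>) \<partial>\<mu>)"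
    by (simp add: shift_moment_def survival_square_strict f_def)
  have "shift_moment (- t) = 2 * (\<integral>s. (\<integral>e. g e s \<partial>\<mu>) \<partial>\<mu>)"
    by (simp add: shift_moment_def survival_square g_def)
  also have "(\<integral>s. (\<integral>e. g e s \<partial>\<mu>) \<partial>\<mu>) = (\<integral>e. (\<integral>s. g e s \<partial>\<mu>) \<partial>\<mu>)"
    using bound by (intro Fubini_bounded[of _ _ _ 1] prob_space_axioms) measurable
  finally have neg: "shift_moment (- t) = 2 * (\<integral>e. (\<integral>s. g e s \<partial>\<mu>) \<partial>\<mu>)" .
  have "(\<integral>e. (\<integral>s. f e s \<partial>\<mu>) \<partial>\<mu>) + (\<integral>e. (\<integral>s. g e s \<partial>\<mu>) \<partial>\<mu>)
      = (\<integral>e. (\<integral>s. f e s \<partial>\<mu>) + (\<integral>s. g e s \<partial>\<mu>) \<partial>\<mu>)"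
    using bound_int
    by (intro Bochner_Integration.integral_add[symmetric] integrable_bounded[of _ 1]) measurable
  also have "\<dots> = (\<integral>e. (\<integral>s. f e s + g e s \<partial>\<mu>) \<partial>\<mu>)"
    using bound
    by (intro Bochner_Integration.integral_cong refl
        Bochner_Integration.integral_add[symmetric] integrable_bounded[of _ 1]) auto
  also have "\<dots> = (\<integral>e. (\<integral>s. (if s - e > t then survival \<mu> s else survival \<mu> e) \<partial>\<mu>) \<partial>\<mu>)"
    by (intro Bochner_Integration.integral_cong refl) (auto simp: f_def g_def)
  finally show ?thesis
    by (simp add: pos neg)
qed

text \<open>
  In the merged integral, raising the threshold from \<open>a\<close> to \<open>b\<close> only affects pairs with
  \<open>a < s - e \<le> b\<close>, where it replaces the survival function at \<open>s\<close> by its value at the smaller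
  point \<open>e\<close>.
\<close>

lemma shift_moment_symmetrized_mono:
  assumes "0 \<le> a" and "a \<le> b"
  shows "shift_moment a + shift_moment (- a) \<le> shift_moment b + shift_moment (- b)"
proof -
  define k where "k t e s = (if s - e > t then survival \<mu> s else survival \<mu> e)" for t e s
  have bound: "\<bar>k t e s\<bar> \<le> 1" for t e s
    using abs_survival_le by (auto simp: k_def)
  have meas [measurable]: "case_prod (k t) \<in> borel_measurable (borel \<Otimes>\<^sub>M borel)"
      "k t e \<in> borel_measurable borel" for t e
    unfolding k_def by measurable
  have bound_int: "\<bar>\<integral>s. k t e s \<partial>\<mu>\<bar> \<le> 1" for t e
    using bound by (auto intro!: abs_integral_le)
  have "k a e s \<le> k b e s" for e s
    using assms by (auto simp: k_def intro!: survival_antimono)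
  then have "(\<integral>s. k a e s \<partial>\<mu>) \<le> (\<integral>s. k b e s \<partial>\<mu>)" for e
    using bound by (intro integral_mono integrable_bounded[of _ 1]) auto
  moreover have "integrable \<mu> (\<lambda>e. \<integral>s. k t e s \<partial>\<mu>)" for t
    using bound_int by (intro integrable_bounded[of _ 1]) measurable
  ultimately have "(\<integral>e. (\<integral>s. k a e s \<partial>\<mu>) \<partial>\<mu>) \<le> (\<integral>e. (\<integral>s. k b e s \<partial>\<mu>) \<partial>\<mu>)"
    by (simp add: integral_mono)
  then show ?thesis
    by (simp add: shift_moment_symmetrized k_def)
qed

text \<open>
  The difference of two independent copies of \<open>X\<close> is symmetric, so only the symmetrized shift
  moment matters, and scaling up the difference can only increase its absolute value.
\<close>

lemma mean_shift_moment_mono: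
  fixes X :: "'b \<Rightarrow> real"
  assumes R: "prob_space R" and X [measurable]: "X \<in> borel_measurable R"
    and "0 \<le> a" and "a \<le> b"
  shows "(\<integral>x. (\<integral>y. shift_moment (a * (X x - X y)) \<partial>R) \<partial>R)
    \<le> (\<integral>x. (\<integral>y. shift_moment (b * (X x - X y)) \<partial>R) \<partial>R)"
proof -
  interpret R: prob_space R by fact
  define \<Psi> where "\<Psi> t = shift_moment t + shift_moment (- t)" for t
  have \<Psi>_meas [measurable]: "\<Psi> \<in> borel_measurable borel"
    unfolding \<Psi>_def by measurable
  have \<Psi>_bound: "\<bar>\<Psi> t\<bar> \<le> 2" for t
    using abs_shift_moment_le[of t] abs_shift_moment_le[of "- t"] by (simp add: \<Psi>_def)
  have \<Psi>_bound_int: "\<bar>\<integral>y. \<Psi> (c * (X x - X y)) \<partial>R\<bar> \<le> 2" for c x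
    using \<Psi>_bound by (intro R.abs_integral_le) auto
  have int_le: "\<bar>\<integral>y. shift_moment (c * (X x - X y)) \<partial>R\<bar> \<le> 1"
      "\<bar>\<integral>y. shift_moment (- (c * (X x - X y))) \<partial>R\<bar> \<le> 1" for c x
    using abs_shift_moment_le by (auto intro!: R.abs_integral_le)
  have sym: "2 * (\<integral>x. (\<integral>y. shift_moment (c * (X x - X y)) \<partial>R) \<partial>R)
      = (\<integral>x. (\<integral>y. \<Psi> (c * (X x - X y)) \<partial>R) \<partial>R)" for c
  proof -
    have "(\<integral>x. (\<integral>y. \<Psi> (c * (X x - X y)) \<partial>R) \<partial>R)
        = (\<integral>x. (\<integral>y. shift_moment (c * (X x - X y)) \<partial>R)
             + (\<integral>y. shift_moment (- (c * (X x - X y))) \<partial>R) \<partial>R)"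
      unfolding \<Psi>_def using abs_shift_moment_le
      by (intro Bochner_Integration.integral_cong refl
          Bochner_Integration.integral_add R.integrable_bounded[of _ 1]) auto
    also have "\<dots> = (\<integral>x. (\<integral>y. shift_moment (c * (X x - X y)) \<partial>R) \<partial>R)
        + (\<integral>x. (\<integral>y. shift_moment (- (c * (X x - X y))) \<partial>R) \<partial>R)"
      using int_le
      by (intro Bochner_Integration.integral_add R.integrable_bounded[of _ 1]) measurable
    also have "(\<integral>x. (\<integral>y. shift_moment (- (c * (X x - X y))) \<partial>R) \<partial>R)
        = (\<integral>x. (\<integral>y. shift_moment (c * (X y - X x)) \<partial>R) \<partial>R)"
      by (simp add: algebra_simps)
    also have "\<dots> = (\<integral>x. (\<integral>y. shift_moment (c * (X x - X y)) \<partial>R) \<partial>R)"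
      using abs_shift_moment_le by (intro Fubini_bounded[of _ _ _ 1] R) measurable
    finally show ?thesis
      by simp
  qed
  have even: "\<Psi> t = \<Psi> \<bar>t\<bar>" for t
    by (simp add: \<Psi>_def abs_if)
  have "\<Psi> (a * d) \<le> \<Psi> (b * d)" for d
  proof -
    have "\<Psi> \<bar>a * d\<bar> \<le> \<Psi> \<bar>b * d\<bar>"
      unfolding \<Psi>_def using assms(3,4)
      by (intro shift_moment_symmetrized_mono) (auto simp: abs_mult intro: mult_right_mono)
    then show ?thesis
      by (simp flip: even)
  qed
  then have "(\<integral>y. \<Psi> (a * (X x - X y)) \<partial>R) \<le> (\<integral>y. \<Psi> (b * (X x - X y)) \<partial>R)" for x
    using \<Psi>_bound by (intro integral_mono R.integrable_bounded[of _ 2]) auto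
  moreover have "integrable R (\<lambda>x. \<integral>y. \<Psi> (c * (X x - X y)) \<partial>R)" for c
    using \<Psi>_bound_int by (intro R.integrable_bounded[of _ 2]) measurable
  ultimately have "(\<integral>x. (\<integral>y. \<Psi> (a * (X x - X y)) \<partial>R) \<partial>R)
      \<le> (\<integral>x. (\<integral>y. \<Psi> (b * (X x - X y)) \<partial>R) \<partial>R)"
    by (simp add: integral_mono)
  then show ?thesis
    by (simp flip: sym)
qed

end

lemma (in prob_space) atomless_distribution_continuous_rv:
  assumes "continuous_rv M X"
  shows "atomless_distribution (distr M borel X)"
proof -
  have X: "X \<in> borel_measurable M"
    using assms by (simp add: continuous_rv_def)
  interpret D: real_distribution "distr M borel X"
    using X by (rule real_distribution_distr)
  show ?thesis
  proof
    fix x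
    have "isCont (cdf (distr M borel X)) x"
      using assms by (simp add: continuous_rv_def continuous_on_eq_continuous_at)
    then show "measure (distr M borel X) {x} = 0"
      by (simp add: D.isCont_cdf)
  qed
qed

section \<open>Additive noise\<close>

text \<open>
  The information contained in the covariates enters only through a \<open>\<sigma>\<close>-algebra \<open>F\<close>
  with respect to which the signal \<open>X\<close> is measurable.
\<close>

locale additive_noise = prob_space M for M :: "'a measure" +
  fixes F :: "'a measure" and X \<epsilon> :: "'a \<Rightarrow> real"
  assumes subalg: "subalgebra M F"
    and X_meas [measurable]: "X \<in> borel_measurable F"
    and \<epsilon>_cont: "continuous_rv M \<epsilon>"
    and indep: "indep_set (sets (sigma_of M \<epsilon>)) (sets F)"
begin

abbreviation noise_law :: "real measure" where
  "noise_law \<equiv> distr M borel \<epsilon>"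

abbreviation restricted :: "'a measure" where
  "restricted \<equiv> restr_to_subalg M F"

lemma \<epsilon>_meas [measurable]: "\<epsilon> \<in> borel_measurable M"
  using \<epsilon>_cont by (simp add: continuous_rv_def)

lemma X_meas_M [measurable]: "X \<in> borel_measurable M"
  using X_meas by (rule measurable_from_subalg[OF subalg])

lemma X_meas_restricted [measurable]: "X \<in> borel_measurable restricted"
  using X_meas by (rule measurable_in_subalg[OF subalg])

lemma prob_space_restricted: "prob_space restricted"
  using subalg prob_space_axioms by (rule prob_space_restr_to_subalg)

sublocale noise: atomless_distribution noise_law
  using \<epsilon>_cont by (rule atomless_distribution_continuous_rv)

lemma id_meas: "(\<lambda>\<omega>. \<omega>) \<in> measurable M F"
  using subalg by (auto simp: subalgebra_def measurable_def)

text \<open>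
  Independence in the form needed for conditioning on \<open>F\<close>: the second coordinate of the joint law is
  the sample point itself, so that it can carry the signal together with any event of \<open>F\<close>.
\<close>

lemma joint_law:
  "noise_law \<Otimes>\<^sub>M restricted = distr M (borel \<Otimes>\<^sub>M F) (\<lambda>\<omega>. (\<epsilon> \<omega>, \<omega>))"
proof (rule pair_measure_eqI)
  note [measurable] = id_meas
  show "sigma_finite_measure noise_law"
    by (rule noise.sigma_finite_measure)
  show "sigma_finite_measure restricted"
    using prob_space_restricted by (simp add: prob_space.axioms(1) finite_measure.axioms(1))
  show "sets (noise_law \<Otimes>\<^sub>M restricted) = sets (distr M (borel \<Otimes>\<^sub>M F) (\<lambda>\<omega>. (\<epsilon> \<omega>, \<omega>)))"
    by (simp add: sets_restr_to_subalg[OF subalg] cong: sets_pair_measure_cong)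
  fix A B assume "A \<in> sets noise_law" and "B \<in> sets restricted"
  then have A [measurable]: "A \<in> sets borel" and B [measurable]: "B \<in> sets F"
    by (simp_all add: sets_restr_to_subalg[OF subalg])
  define A' where "A' = \<epsilon> -` A \<inter> space M"
  have A': "A' \<in> sets (sigma_of M \<epsilon>)"
    unfolding A'_def sigma_of_def by (rule in_vimage_algebra) fact
  have BM: "B \<in> sets M"
    using B subalg by (auto simp: subalgebra_def)
  have "emeasure (distr M (borel \<Otimes>\<^sub>M F) (\<lambda>\<omega>. (\<epsilon> \<omega>, \<omega>))) (A \<times> B)
      = emeasure M ((\<lambda>\<omega>. (\<epsilon> \<omega>, \<omega>)) -` (A \<times> B) \<inter> space M)"
    by (rule emeasure_distr) measurable
  also have "(\<lambda>\<omega>. (\<epsilon> \<omega>, \<omega>)) -` (A \<times> B) \<inter> space M = A' \<inter> B"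
    using sets.sets_into_space[OF BM] by (auto simp: A'_def)
  also have "emeasure M (A' \<inter> B) = emeasure M A' * emeasure M B"
    using indep_setD[OF indep A' B] by (simp add: emeasure_eq_measure ennreal_mult)
  finally show "emeasure noise_law A * emeasure restricted B
      = emeasure (distr M (borel \<Otimes>\<^sub>M F) (\<lambda>\<omega>. (\<epsilon> \<omega>, \<omega>))) (A \<times> B)"
    by (simp add: emeasure_distr emeasure_restr_to_subalg[OF subalg] A'_def)
qed

lemma expectation_joint:
  fixes g :: "real \<Rightarrow> 'a \<Rightarrow> real"
  assumes g: "case_prod g \<in> borel_measurable (borel \<Otimes>\<^sub>M F)" and bound: "\<And>e \<omega>. \<bar>g e \<omega>\<bar> \<le> B"
  shows "(\<integral>\<omega>. g (\<epsilon> \<omega>) \<omega> \<partial>M) = (\<integral>\<omega>. (\<integral>e. g e \<omega> \<partial>noise_law) \<partial>restricted)"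
proof -
  note [measurable] = id_meas
  have sets_eq: "sets (noise_law \<Otimes>\<^sub>M restricted) = sets (borel \<Otimes>\<^sub>M F)"
    by (simp add: sets_restr_to_subalg[OF subalg] cong: sets_pair_measure_cong)
  have "(\<integral>\<omega>. g (\<epsilon> \<omega>) \<omega> \<partial>M) = (\<integral>z. case_prod g z \<partial>distr M (borel \<Otimes>\<^sub>M F) (\<lambda>\<omega>. (\<epsilon> \<omega>, \<omega>)))"
    using g by (subst integral_distr) auto
  also have "\<dots> = (\<integral>z. case_prod g z \<partial>(noise_law \<Otimes>\<^sub>M restricted))"
    by (simp only: joint_law)
  also have "\<dots> = (\<integral>\<omega>. (\<integral>e. case_prod g (e, \<omega>) \<partial>noise_law) \<partial>restricted)"
    using g bound
    by (intro integral_pair_bounded[of _ _ _ B] noise.prob_space_axioms prob_space_restricted)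
      (auto simp: measurable_cong_sets[OF sets_eq refl])
  finally show ?thesis
    by simp
qed

definition response :: "real \<Rightarrow> 'a \<Rightarrow> real" where
  "response \<eta> \<omega> = \<eta> * X \<omega> + \<epsilon> \<omega>"

abbreviation response_law :: "real \<Rightarrow> real measure" where
  "response_law \<eta> \<equiv> distr M borel (response \<eta>)"

lemma response_meas [measurable]: "response \<eta> \<in> borel_measurable M"
  unfolding response_def by measurable

lemma integral_response_law:
  fixes g :: "real \<Rightarrow> real"
  assumes g [measurable]: "g \<in> borel_measurable borel" and bound: "\<And>y. \<bar>g y\<bar> \<le> B"
  shows "(\<integral>y. g y \<partial>response_law \<eta>)
    = (\<integral>\<omega>. (\<integral>e. g (\<eta> * X \<omega> + e) \<partial>noise_law) \<partial>restricted)"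
proof -
  have "(\<integral>y. g y \<partial>response_law \<eta>) = (\<integral>\<omega>. g (\<eta> * X \<omega> + \<epsilon> \<omega>) \<partial>M)"
    unfolding response_def[symmetric] by (rule integral_distr) measurable
  also have "\<dots> = (\<integral>\<omega>. (\<integral>e. g (\<eta> * X \<omega> + e) \<partial>noise_law) \<partial>restricted)"
    using bound by (intro expectation_joint[of "\<lambda>e \<omega>. g (\<eta> * X \<omega> + e)" B]) measurable
  finally show ?thesis .
qed

text \<open>Given the signal, hitting a fixed value of the response pins the noise to a single point.\<close>

lemma atomless_response_law: "atomless_distribution (response_law \<eta>)"
proof -
  interpret Y: real_distribution "response_law \<eta>"
    by (rule real_distribution_distr) measurable
  show ?thesis
  proof
    fix y
    have "measure (response_law \<eta>) {y} = (\<integral>z. indicator {y} z \<partial>response_law \<eta>)"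
      by simp
    also have "\<dots> = (\<integral>\<omega>. (\<integral>e. indicator {y} (\<eta> * X \<omega> + e) \<partial>noise_law) \<partial>restricted)"
      by (rule integral_response_law[of _ 1]) (auto simp: indicator_def)
    also have "\<dots> = (\<integral>\<omega>. (\<integral>e. indicator {y - \<eta> * X \<omega>} e \<partial>noise_law) \<partial>restricted)"
      by (intro Bochner_Integration.integral_cong refl) (auto simp: indicator_def)
    also have "\<dots> = 0"
      by (simp add: noise.atomless)
    finally show "measure (response_law \<eta>) {y} = 0" .
  qed
qed

lemma response_ge_meas: "{\<omega>. response \<eta> \<omega> \<ge> y} \<inter> space M \<in> sets M"
  by measurable

lemma indicator_response_ge_meas [measurable]:
  "(indicator {\<omega>. response \<eta> \<omega> \<ge> y} :: 'a \<Rightarrow> real) \<in> borel_measurable M"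
  using response_ge_meas by (simp add: borel_measurable_indicator_iff)

lemma integrable_indicator_response_ge:
  "integrable M (indicator {\<omega>. response \<eta> \<omega> \<ge> y} :: 'a \<Rightarrow> real)"
  by (rule integrable_bounded[of _ 1]) (auto simp: indicator_def)

lemma prob_response_ge:
  "prob ({\<omega>. response \<eta> \<omega> \<ge> y} \<inter> space M) = survival (response_law \<eta>) y"
proof -
  have "response \<eta> -` {y..} \<inter> space M = {\<omega>. response \<eta> \<omega> \<ge> y} \<inter> space M"
    by auto
  then show ?thesis
    by (simp add: survival_def measure_distr)
qed

text \<open>Freezing lemma: conditionally on \<open>F\<close> the signal is a constant and the noise keeps its law.\<close>

lemma cond_prob_response_ge:
  "AE \<omega> in M. real_cond_exp M F (indicator {\<omega>. response \<eta> \<omega> \<ge> y}) \<omega>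
     = survival noise_law (y - \<eta> * X \<omega>)"
proof -
  interpret finite_measure_subalgebra M F
    by standard (rule subalg)
  show ?thesis
  proof (rule real_cond_exp_charact)
    fix A assume A [measurable]: "A \<in> sets F"
    \<comment> \<open>the event of interest as a function of noise and sample point, which are independent\<close>
    define g :: "real \<Rightarrow> 'a \<Rightarrow> real"
      where "g e \<omega> = indicator A \<omega> * (if y - \<eta> * X \<omega> \<le> e then 1 else 0)" for e \<omega>
    have "(\<integral>\<omega>\<in>A. indicator {\<omega>. response \<eta> \<omega> \<ge> y} \<omega> \<partial>M) = (\<integral>\<omega>. g (\<epsilon> \<omega>) \<omega> \<partial>M)"
      unfolding set_lebesgue_integral_def
      by (intro Bochner_Integration.integral_cong) (auto simp: g_def indicator_def response_def)
    also have "\<dots> = (\<integral>\<omega>. (\<integral>e. g e \<omega> \<partial>noise_law) \<partial>restricted)"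
      by (rule expectation_joint[of _ 1]) (simp add: g_def, auto simp: g_def indicator_def)
    also have "\<dots> = (\<integral>\<omega>. (\<integral>e. indicator A \<omega> * indicator {y - \<eta> * X \<omega>..} e \<partial>noise_law) \<partial>restricted)"
      by (intro Bochner_Integration.integral_cong refl) (auto simp: g_def indicator_def)
    also have "\<dots> = (\<integral>\<omega>. indicator A \<omega> * survival noise_law (y - \<eta> * X \<omega>) \<partial>restricted)"
      by (simp add: survival_def)
    also have "\<dots> = (\<integral>\<omega>. indicator A \<omega> * survival noise_law (y - \<eta> * X \<omega>) \<partial>M)"
      by (rule integral_subalgebra2[OF subalg]) measurable
    finally show "(\<integral>\<omega>\<in>A. indicator {\<omega>. response \<eta> \<omega> \<ge> y} \<omega> \<partial>M)
        = (\<integral>\<omega>\<in>A. survival noise_law (y - \<eta> * X \<omega>) \<partial>M)"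
      by (simp add: set_lebesgue_integral_def)
  next
    show "integrable M (\<lambda>\<omega>. survival noise_law (y - \<eta> * X \<omega>))"
      using noise.abs_survival_le by (intro integrable_bounded[of _ 1]) auto
  qed (auto simp: integrable_indicator_response_ge)
qed

lemma variance_indicator_response_ge:
  "variance (indicator {\<omega>. response \<eta> \<omega> \<ge> y} :: 'a \<Rightarrow> real)
    = survival (response_law \<eta>) y - (survival (response_law \<eta>) y)\<^sup>2"
proof -
  have sq: "(\<lambda>\<omega>. (indicator {\<omega>. response \<eta> \<omega> \<ge> y} \<omega> :: real)\<^sup>2) = indicator {\<omega>. response \<eta> \<omega> \<ge> y}"
    by (auto simp: indicator_def)
  show ?thesis
    using integrable_indicator_response_ge
    by (subst variance_eq) (simp_all add: sq prob_response_ge)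
qed

lemma variance_cond_prob_response_ge:
  "variance (real_cond_exp M F (indicator {\<omega>. response \<eta> \<omega> \<ge> y}))
    = (\<integral>\<omega>. (survival noise_law (y - \<eta> * X \<omega>))\<^sup>2 \<partial>restricted) - (survival (response_law \<eta>) y)\<^sup>2"
proof -
  interpret finite_measure_subalgebra M F
    by standard (rule subalg)
  let ?C = "real_cond_exp M F (indicator {\<omega>. response \<eta> \<omega> \<ge> y})"
  note AE = cond_prob_response_ge[of y \<eta>]
  have mean: "expectation ?C = survival (response_law \<eta>) y"
    using real_cond_exp_int(2)[OF integrable_indicator_response_ge]
    by (simp add: prob_response_ge)
  have sq_int: "integrable M (\<lambda>\<omega>. (survival noise_law (y - \<eta> * X \<omega>))\<^sup>2)"
    using noise.abs_survival_square_le by (intro integrable_bounded[of _ 1]) auto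
  have sq_AE: "AE \<omega> in M. (?C \<omega>)\<^sup>2 = (survival noise_law (y - \<eta> * X \<omega>))\<^sup>2"
    using AE by eventually_elim simp
  have "integrable M (\<lambda>\<omega>. (?C \<omega>)\<^sup>2)"
    using sq_int by (subst integrable_cong_AE[OF _ _ sq_AE]) auto
  then have "variance ?C = expectation (\<lambda>\<omega>. (?C \<omega>)\<^sup>2) - (expectation ?C)\<^sup>2"
    by (intro variance_eq real_cond_exp_int(1) integrable_indicator_response_ge)
  also have "expectation (\<lambda>\<omega>. (?C \<omega>)\<^sup>2) = (\<integral>\<omega>. (survival noise_law (y - \<eta> * X \<omega>))\<^sup>2 \<partial>M)"
    by (rule integral_cong_AE[OF _ _ sq_AE]) auto
  also have "\<dots> = (\<integral>\<omega>. (survival noise_law (y - \<eta> * X \<omega>))\<^sup>2 \<partial>restricted)"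
    by (rule integral_subalgebra2[OF subalg, symmetric]) measurable
  finally show ?thesis
    by (simp add: mean)
qed

lemma integral_variance_indicator:
  "(\<integral>y. variance (indicator {\<omega>. response \<eta> \<omega> \<ge> y} :: 'a \<Rightarrow> real) \<partial>response_law \<eta>) = 1/6"
proof -
  interpret Y: atomless_distribution "response_law \<eta>"
    by (rule atomless_response_law)
  have "(\<integral>y. survival (response_law \<eta>) y - (survival (response_law \<eta>) y)\<^sup>2 \<partial>response_law \<eta>)
      = (\<integral>y. survival (response_law \<eta>) y \<partial>response_law \<eta>)
        - (\<integral>y. (survival (response_law \<eta>) y)\<^sup>2 \<partial>response_law \<eta>)"
    using Y.abs_survival_le Y.abs_survival_square_le
    by (intro Bochner_Integration.integral_diff Y.integrable_bounded[of _ 1]) auto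
  then show ?thesis
    unfolding variance_indicator_response_ge
    by (simp add: Y.integral_survival Y.integral_survival_square)
qed

text \<open>
  The response at which the conditional survival function is evaluated splits into a signal and a noise
  part. Integrating out the noise first leaves a shift moment of the difference between this signal and the
  independent copy of it that was conditioned on.
\<close>

lemma integral_variance_cond_prob:
  "(\<integral>y. variance (real_cond_exp M F (indicator {\<omega>. response \<eta> \<omega> \<ge> y})) \<partial>response_law \<eta>)
    = (\<integral>\<omega>. (\<integral>\<omega>'. noise.shift_moment (\<eta> * (X \<omega> - X \<omega>')) \<partial>restricted) \<partial>restricted) - 1/3"
proof -
  interpret Y: atomless_distribution "response_law \<eta>"
    by (rule atomless_response_law)
  interpret R: prob_space restricted
    by (rule prob_space_restricted)
  define G where "G y = (\<integral>\<omega>'. (survival noise_law (y - \<eta> * X \<omega>'))\<^sup>2 \<partial>restricted)" for y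
  have G_meas [measurable]: "G \<in> borel_measurable borel"
    unfolding G_def by measurable
  have G_bound: "\<bar>G y\<bar> \<le> 1" for y
    unfolding G_def using noise.abs_survival_square_le by (intro R.abs_integral_le) auto
  have "(\<integral>y. variance (real_cond_exp M F (indicator {\<omega>. response \<eta> \<omega> \<ge> y})) \<partial>response_law \<eta>)
      = (\<integral>y. G y - (survival (response_law \<eta>) y)\<^sup>2 \<partial>response_law \<eta>)"
    by (simp add: variance_cond_prob_response_ge G_def)
  also have "\<dots> = (\<integral>y. G y \<partial>response_law \<eta>) - (\<integral>y. (survival (response_law \<eta>) y)\<^sup>2 \<partial>response_law \<eta>)"
    using G_bound Y.abs_survival_square_le
    by (intro Bochner_Integration.integral_diff Y.integrable_bounded[of _ 1]) auto
  also have "\<dots> = (\<integral>y. G y \<partial>response_law \<eta>) - 1/3"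
    by (simp add: Y.integral_survival_square)
  also have "(\<integral>y. G y \<partial>response_law \<eta>)
      = (\<integral>\<omega>. (\<integral>e. G (\<eta> * X \<omega> + e) \<partial>noise_law) \<partial>restricted)"
    using G_bound by (intro integral_response_law[of _ 1]) auto
  also have "\<dots> = (\<integral>\<omega>. (\<integral>\<omega>'. noise.shift_moment (\<eta> * (X \<omega> - X \<omega>')) \<partial>restricted) \<partial>restricted)"
    unfolding G_def by (simp add: noise.integral_survival_square_shift[OF prob_space_restricted] right_diff_distrib)
  finally show ?thesis .
qed

end

(* The noise is independent of the whole vector Z, hence of h(Z). Independence of h(Z) alone does not
   suffice: if the other coordinates of Z carry information on the noise, monotonicity can fail.
   indep_var needs equal value types, so independence is stated for the generated sigma-algebras.
   Measurability w.r.t. sigma(Z) says that h(Z) is a random variable as a function of Z; every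
   Borel function h satisfies it. *)
theorem proposition4:
  fixes M :: "'a measure"
    and Z :: "'a \<Rightarrow> real ^ 'n"
    and h :: "real ^ 'n \<Rightarrow> real"
    and \<epsilon> :: "'a \<Rightarrow> real"
    and \<eta>\<^sub>1 \<eta>\<^sub>2 :: real
  assumes "prob_space M"
    and "Z \<in> borel_measurable M"
    and "(\<lambda>\<omega>. h (Z \<omega>)) \<in> borel_measurable (sigma_of M Z)"
    and "continuous_rv M \<epsilon>"
    and "continuous_rv M (\<lambda>\<omega>. h (Z \<omega>))"
    and "prob_space.indep_set M (sets (sigma_of M \<epsilon>)) (sets (sigma_of M Z))"
    and "0 \<le> \<eta>\<^sub>1" and "\<eta>\<^sub>1 < \<eta>\<^sub>2"
  shows "T_AC M (\<lambda>\<omega>. \<eta>\<^sub>1 * h (Z \<omega>) + \<epsilon> \<omega>) Z \<le> T_AC M (\<lambda>\<omega>. \<eta>\<^sub>2 * h (Z \<omega>) + \<epsilon> \<omega>) Z"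
proof -
  interpret prob_space M by fact
  have "subalgebra M (sigma_of M Z)"
    using assms(2) by (auto simp: subalgebra_def sigma_of_def sets_vimage_algebra2)
  then interpret additive_noise M "sigma_of M Z" "\<lambda>\<omega>. h (Z \<omega>)" \<epsilon>
    using assms by unfold_locales auto
  have response_eq: "(\<lambda>\<omega>. \<eta> * h (Z \<omega>) + \<epsilon> \<omega>) = response \<eta>" for \<eta>
    by (simp add: response_def fun_eq_iff)
  have T_AC_eq: "T_AC M (\<lambda>\<omega>. \<eta> * h (Z \<omega>) + \<epsilon> \<omega>) Z
      = 6 * (\<integral>\<omega>. (\<integral>\<omega>'. noise.shift_moment (\<eta> * (h (Z \<omega>) - h (Z \<omega>'))) \<partial>restricted) \<partial>restricted) - 2"
    for \<eta>
    unfolding response_eq T_AC_def cond_survival_def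
    by (simp only: integral_variance_indicator integral_variance_cond_prob) simp
  show ?thesis
    unfolding T_AC_eq
    using noise.mean_shift_moment_mono[OF prob_space_restricted X_meas_restricted, of \<eta>\<^sub>1 \<eta>\<^sub>2] assms(7,8)
    by simp
qed

end
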